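(* For every $n\ge 2$ and every $\sigma\in I_n$, the sequence $\Theta^{n-2}(\sigma)$ is fixed by $\Theta$, i.e. $\Theta^{n-1}(\sigma)=\Theta^{n-2}(\sigma)$.
   Context: $I_n$ is the set of inversion sequences of length $n$, i.e. integer sequences $\sigma=(\sigma_1,\ldots,\sigma_n)$ with $0\le\sigma_i<i$ for every $1\le i\le n$. For a finite integer sequence $\sigma$ of length $n$, $\Theta(\sigma)$ is the sequence of length $n$ defined by $\Theta(\sigma)_i=\#\{j<i:\sigma_j<\sigma_i\}$. $\Theta^k$ denotes the $k$-fold iterate of $\Theta$, with $\Theta^0$ the identity. *)

theory Defs
  imports Main
begin

text \<open>
  A sequence with entries indexed from 1 to n is a list of length n, whose entry number i
  is \<open>\<sigma> ! (i - 1)\<close>; so the bound \<open>\<sigma>_i < i\<close> becomes \<open>\<sigma> ! i < i + 1\<close> in list positions.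
\<close>

definition inversion_sequences :: "nat \<Rightarrow> int list set" where
  "inversion_sequences n =
     {\<sigma>. length \<sigma> = n \<and> (\<forall>i<n. 0 \<le> \<sigma> ! i \<and> \<sigma> ! i < int i + 1)}"

definition Theta :: "int list \<Rightarrow> int list" where
  "Theta \<sigma> = map (\<lambda>i. int (card {j. j < i \<and> \<sigma> ! j < \<sigma> ! i})) [0..<length \<sigma>]"

end

theory Submission
  imports Defs
begin

text \<open>
  On inversion sequences \<open>\<Theta>\<close> increases every entry weakly, because the first \<open>\<sigma>\<^sub>i\<close> entries are
  smaller than \<open>\<sigma>\<^sub>i\<close>. If entry \<open>i\<close> does not move in one step, then these are the only earlier
  entries below \<open>\<sigma>\<^sub>i\<close>; as the other entries can only grow, entry \<open>i\<close> never moves again. An entry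
  that moves at all therefore starts at a value at least 1 and grows strictly until it stops, and
  it is bounded by \<open>n - 1\<close>, so it stops after at most \<open>n - 2\<close> steps.
\<close>

lemma inversion_sequencesD:
  assumes "\<sigma> \<in> inversion_sequences n"
  shows "length \<sigma> = n" "i < n \<Longrightarrow> 0 \<le> \<sigma> ! i" "i < n \<Longrightarrow> \<sigma> ! i \<le> int i"
  using assms by (force simp: inversion_sequences_def)+

lemma length_Theta [simp]: "length (Theta \<sigma>) = length \<sigma>"
  by (simp add: Theta_def)

lemma Theta_nth:
  "i < length \<sigma> \<Longrightarrow> Theta \<sigma> ! i = int (card {j. j < i \<and> \<sigma> ! j < \<sigma> ! i})"
  by (simp add: Theta_def)

lemma Theta_in_inversion_sequences:
  assumes "\<sigma> \<in> inversion_sequences n"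
  shows "Theta \<sigma> \<in> inversion_sequences n"
proof -
  have "card {j. j < i \<and> \<sigma> ! j < \<sigma> ! i} \<le> i" for i
    using card_mono[of "{..<i}" "{j. j < i \<and> \<sigma> ! j < \<sigma> ! i}"] by auto
  then show ?thesis
    using inversion_sequencesD(1)[OF assms]
    by (auto simp: inversion_sequences_def Theta_nth less_Suc_eq_le)
qed

lemma funpow_Theta_in_inversion_sequences:
  "\<sigma> \<in> inversion_sequences n \<Longrightarrow> (Theta ^^ k) \<sigma> \<in> inversion_sequences n"
  by (induction k) (simp_all add: Theta_in_inversion_sequences)

text \<open>For j below \<sigma>_i the bound on inversion sequences gives \<sigma>_j \<le> j <
  \<sigma>_i \<le> i, with positions counted from 0.\<close>

lemma initial_entries_less:
  assumes "\<sigma> \<in> inversion_sequences n" "i < n"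
  shows "{..<nat (\<sigma> ! i)} \<subseteq> {j. j < i \<and> \<sigma> ! j < \<sigma> ! i}"
proof
  fix j assume "j \<in> {..<nat (\<sigma> ! i)}"
  then have "int j < \<sigma> ! i" by auto
  moreover from this have "j < i"
    using inversion_sequencesD(3)[OF assms] by linarith
  ultimately show "j \<in> {j. j < i \<and> \<sigma> ! j < \<sigma> ! i}"
    using inversion_sequencesD(3)[OF assms(1), of j] assms(2) by auto
qed

lemma Theta_nth_ge:
  assumes "\<sigma> \<in> inversion_sequences n" "i < n"
  shows "\<sigma> ! i \<le> Theta \<sigma> ! i"
  using card_mono[OF _ initial_entries_less[OF assms]] assms inversion_sequencesD(1)[OF assms(1)]
  by (simp add: Theta_nth)

text \<open>The new entry is the size of \<open>?A\<close>, the old one that of its subset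
  \<open>?B\<close>. These finite sets have equal size only if they coincide, that is, if
  \<open>?A\<close> has no position outside \<open>?B\<close>.\<close>

lemma Theta_nth_eq_iff:
  assumes "\<sigma> \<in> inversion_sequences n" "i < n"
  shows "Theta \<sigma> ! i = \<sigma> ! i \<longleftrightarrow> (\<forall>j<i. \<sigma> ! j < \<sigma> ! i \<longrightarrow> int j < \<sigma> ! i)"
proof -
  let ?A = "{j. j < i \<and> \<sigma> ! j < \<sigma> ! i}" and ?B = "{..<nat (\<sigma> ! i)}"
  have sub: "?B \<subseteq> ?A" by (rule initial_entries_less[OF assms])
  have "Theta \<sigma> ! i = \<sigma> ! i \<longleftrightarrow> card ?B = card ?A"
  proof -
    have "Theta \<sigma> ! i = int (card ?A)"
      using assms inversion_sequencesD(1)[OF assms(1)] by (simp add: Theta_nth)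
    moreover have "\<sigma> ! i = int (card ?B)"
      using inversion_sequencesD(2)[OF assms] by simp
    ultimately show ?thesis by linarith
  qed
  also have "\<dots> \<longleftrightarrow> ?B = ?A"
  proof
    show "?B = ?A" if "card ?B = card ?A"
      by (rule card_subset_eq[OF _ sub that]) simp
  qed (rule arg_cong)
  also have "\<dots> \<longleftrightarrow> ?A \<subseteq> ?B"
    using sub by auto
  also have "\<dots> \<longleftrightarrow> (\<forall>j<i. \<sigma> ! j < \<sigma> ! i \<longrightarrow> int j < \<sigma> ! i)"
    by (simp add: subset_iff zless_nat_eq_int_zless) blast
  finally show ?thesis .
qed

lemma Theta_nth_fixed_persists:
  assumes "\<sigma> \<in> inversion_sequences n" "i < n" "Theta \<sigma> ! i = \<sigma> ! i"
  shows "Theta (Theta \<sigma>) ! i = Theta \<sigma> ! i"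
proof -
  \<comment> \<open>Entry j did not decrease and entry i kept its value, so \<sigma>_j < \<sigma>_i
    held already and the criterion for \<sigma> applies.\<close>
  have "int j < Theta \<sigma> ! i" if "j < i" "Theta \<sigma> ! j < Theta \<sigma> ! i" for j
    using that assms Theta_nth_ge[OF assms(1), of j] Theta_nth_eq_iff[OF assms(1,2)] by auto
  then show ?thesis
    using Theta_nth_eq_iff[OF Theta_in_inversion_sequences[OF assms(1)] assms(2)] by blast
qed

text \<open>This is the invariant that turns strict growth into a bound on the number of
  steps.\<close>

lemma funpow_Theta_nth_fixed_or_large:
  assumes "\<sigma> \<in> inversion_sequences n" "i < n"
  shows "Theta ((Theta ^^ k) \<sigma>) ! i = (Theta ^^ k) \<sigma> ! i \<or> int k < (Theta ^^ k) \<sigma> ! i"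
proof (induction k)
  case 0
  \<comment> \<open>An entry 0 has no smaller entry before it, so the criterion holds vacuously and
    the entry is fixed.\<close>
  have "0 \<le> \<sigma> ! j" if "j \<le> i" for j
    using inversion_sequencesD(2)[OF assms(1), of j] assms(2) that by simp
  then have "0 < \<sigma> ! i \<or> (\<forall>j<i. \<not> \<sigma> ! j < \<sigma> ! i)"
    by (meson less_imp_le order.strict_trans1)
  then show ?case
    using Theta_nth_eq_iff[OF assms] by auto
next
  case (Suc k)
  have I: "(Theta ^^ k) \<sigma> \<in> inversion_sequences n"
    by (rule funpow_Theta_in_inversion_sequences[OF assms(1)])
  show ?case
  proof (cases "Theta ((Theta ^^ k) \<sigma>) ! i = (Theta ^^ k) \<sigma> ! i")
    case True
    then show ?thesis
      using Theta_nth_fixed_persists[OF I assms(2)] by simp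
  next
    case False
    \<comment> \<open>The entry still moves, so by induction it exceeds k, and this step raises it
      by at least 1.\<close>
    then show ?thesis
      using Suc Theta_nth_ge[OF I assms(2)] by simp
  qed
qed

theorem proposition3p5:
  fixes n :: nat and \<sigma> :: "int list"
  assumes "n \<ge> 2"
    and "\<sigma> \<in> inversion_sequences n"
  shows "Theta ((Theta ^^ (n - 2)) \<sigma>) = (Theta ^^ (n - 2)) \<sigma>"
proof (rule nth_equalityI)
  let ?\<tau> = "(Theta ^^ (n - 2)) \<sigma>"
  have I: "?\<tau> \<in> inversion_sequences n"
    by (rule funpow_Theta_in_inversion_sequences[OF assms(2)])
  show "length (Theta ?\<tau>) = length ?\<tau>" by simp
  fix i assume "i < length (Theta ?\<tau>)"
  then have i: "i < n"
    using inversion_sequencesD(1)[OF I] by simp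
  \<comment> \<open>A value above n - 2 is at least n - 1, which bounds every entry of
    \<open>Theta ?\<tau>\<close>.\<close>
  have "Theta ?\<tau> ! i \<le> ?\<tau> ! i" if "int (n - 2) < ?\<tau> ! i"
    using that i inversion_sequencesD(3)[OF Theta_in_inversion_sequences[OF I] i] by linarith
  then show "Theta ?\<tau> ! i = ?\<tau> ! i"
    using funpow_Theta_nth_fixed_or_large[OF assms(2) i, of "n - 2"] Theta_nth_ge[OF I i]
    by (auto intro: antisym)
qed

end
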